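(* With the scalars $a$, $d$, $\theta_i$, $t_i$ attached to the $\mathcal O_q$-module $V$ as described in the context, for $0\le r\le s\le d$, $$\frac{t_r}{t_s}=\sum_{i=0}^{s-r}\frac{a^{-i}q^{i(2s-d)}(\theta_r-\theta_s)(\theta_r-\theta_{s-1})\cdots(\theta_r-\theta_{s-i+1})}{(q^2;q^2)_i},$$ $$\frac{t_s}{t_r}=\sum_{i=0}^{s-r}\frac{a^{i}q^{i(d-2s)}(\theta_r-\theta_s)(\theta_r-\theta_{s-1})\cdots(\theta_r-\theta_{s-i+1})}{(q^{-2};q^{-2})_i}.$$
   Context: Setting. $\mathbb F$ is a field and $q\in\mathbb F$ is nonzero and not a root of unity. Algebras are associative, unital, over $\mathbb F$. Write $[X,Y]=XY-YX$, $[X,Y]_q=qXY-q^{-1}YX$, $[X,Y]_{q^{-1}}=q^{-1}XY-qYX$. The $q$-Onsager algebra $\mathcal O_q$ is defined by generators $A,A^*$ and relations $[A,[A,[A,A^*]_q]_{q^{-1}}]=(q^2-q^{-2})^2[A^*,A]$ and $[A^*,[A^*,[A^*,A]_q]_{q^{-1}}]=(q^2-q^{-2})^2[A,A^*]$. $V$ is an irreducible $\mathcal O_q$-module of finite dimension at least $2$ on which each of $A,A^*$ is diagonalizable. Scalars. The eigenvalues of $A$ on $V$ can be ordered as mutually distinct $\theta_0,\dots,\theta_d$ ($d\ge 1$) such that $\theta_i=aq^{d-2i}+a^{-1}q^{2i-d}$ ($0\le i\le d$) for some nonzero $a\in\mathbb F$; fix such an ordering and $a$. Let $t_{ij}=1+\frac{\theta_i-\theta_j}{q-q^{-1}}\cdot\frac{q\theta_i-q^{-1}\theta_j}{q^2-q^{-2}}$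 and $t_i=t_{01}t_{12}\cdots t_{i-1,i}$ ($0\le i\le d$, $t_0=1$); each $t_i$ is nonzero. Notation. $(z;t)_n=(1-z)(1-zt)\cdots(1-zt^{n-1})$ for $n\in\mathbb N=\{0,1,2,\dots\}$; empty products equal $1$. *)

theory Defs
  imports "HOL-Algebra.QuotRing" "HOL-Algebra.Algebraic_Closure_Type" "HOL-Library.Poly_Mapping"
begin

section \<open>The free algebra on two generators\<close>

datatype gen = gen_A | gen_Astar

text \<open>The free monoid on the two generators, written additively because the convolution
  product of \<^theory>\<open>HOL-Library.Poly_Mapping\<close> expects an additive monoid of exponents.\<close>

datatype word = Word (letters: "gen list")

instantiation word :: monoid_add
begin
definition zero_word :: word where "0 = Word []"
definition plus_word :: "word \<Rightarrow> word \<Rightarrow> word" where "u + v = Word (letters u @ letters v)"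
instance by standard (simp_all add: zero_word_def plus_word_def)
end

type_synonym 'f free_alg = "word \<Rightarrow>\<^sub>0 'f"

definition fconst :: "'f::field \<Rightarrow> 'f free_alg" where
  "fconst c = Poly_Mapping.single 0 c"

definition fgen :: "gen \<Rightarrow> 'f::field free_alg" where
  "fgen g = Poly_Mapping.single (Word [g]) 1"

definition comm :: "'f::field free_alg \<Rightarrow> 'f free_alg \<Rightarrow> 'f free_alg" where
  "comm x y = x * y - y * x"

text \<open>\<open>[x,y]\<^sub>q\<close>; the bracket \<open>[x,y]\<close> with subscript \<open>q\<close> inverse is \<open>qcomm (inverse q) x y\<close>.\<close>

definition qcomm :: "'f::field \<Rightarrow> 'f free_alg \<Rightarrow> 'f free_alg \<Rightarrow> 'f free_alg" where
  "qcomm q x y = fconst q * x * y - fconst (inverse q) * y * x"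


section \<open>The q-Onsager algebra\<close>

text \<open>The difference of the two sides of the q-Dolan/Grady relation
  \<open>[x,[x,[x,y]\<^sub>q]] = (q\<^sup>2 - q\<^sup>-\<^sup>2)\<^sup>2 [y,x]\<close>, where the middle bracket on the left
  has subscript \<open>q\<close> inverse.\<close>

definition dolan_grady :: "'f::field \<Rightarrow> 'f free_alg \<Rightarrow> 'f free_alg \<Rightarrow> 'f free_alg" where
  "dolan_grady q x y =
     comm x (qcomm (inverse q) x (qcomm q x y)) - fconst ((q^2 - inverse (q^2))^2) * comm y x"

text \<open>Note that \<^const>\<open>genideal\<close> is the two-sided ideal generated by a set.\<close>

definition onsager_ideal :: "'f::field \<Rightarrow> 'f free_alg set" where
  "onsager_ideal q = genideal ring_of_type_algebra
     {dolan_grady q (fgen gen_A) (fgen gen_Astar), dolan_grady q (fgen gen_Astar) (fgen gen_A)}"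

definition onsager_algebra :: "'f::field \<Rightarrow> 'f free_alg set ring" where
  "onsager_algebra q = ring_of_type_algebra Quot onsager_ideal q"

definition onsager_proj :: "'f::field \<Rightarrow> 'f free_alg \<Rightarrow> 'f free_alg set" where
  "onsager_proj q x = onsager_ideal q +>\<^bsub>ring_of_type_algebra\<^esub> x"

definition onsager_A :: "'f::field \<Rightarrow> 'f free_alg set" where
  "onsager_A q = onsager_proj q (fgen gen_A)"

definition onsager_Astar :: "'f::field \<Rightarrow> 'f free_alg set" where
  "onsager_Astar q = onsager_proj q (fgen gen_Astar)"

definition onsager_scalar :: "'f::field \<Rightarrow> 'f \<Rightarrow> 'f free_alg set" where
  "onsager_scalar q c = onsager_proj q (fconst c)"

lemma ring_free_alg: "ring (ring_of_type_algebra :: 'f::field free_alg ring)"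
proof -
  have "\<exists>y. x + y = 0" for x :: "'f free_alg"
    using add.right_inverse by blast
  thus ?thesis
    unfolding ring_of_type_algebra_def using add.right_inverse
    by unfold_locales (auto simp: algebra_simps Units_def)
qed

lemma ideal_onsager_ideal: "ideal (onsager_ideal q) ring_of_type_algebra"
  unfolding onsager_ideal_def
  by (rule ring.genideal_ideal[OF ring_free_alg]) (simp add: ring_of_type_algebra_def)

lemma ring_onsager_algebra: "ring (onsager_algebra q)"
  unfolding onsager_algebra_def by (rule ideal.quotient_is_ring[OF ideal_onsager_ideal])


section \<open>Modules\<close>

context vector_space
begin

definition eigenvalues :: "('b \<Rightarrow> 'b) \<Rightarrow> 'a set" where
  "eigenvalues f = {c. \<exists>v. v \<noteq> 0 \<and> f v = c *s v}"

definition diagonalizable :: "('b \<Rightarrow> 'b) \<Rightarrow> bool" where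
  "diagonalizable f \<longleftrightarrow> span {v. \<exists>c. f v = c *s v} = UNIV"

definition finite_dim :: bool where
  "finite_dim \<longleftrightarrow> (\<exists>B. finite B \<and> span B = UNIV)"

end

text \<open>A left module over the q-Onsager algebra, as an algebra over the field: the underlying
  vector space is the whole type \<open>'v\<close>, and \<open>act x\<close> is only meaningful for
  \<open>x\<close> in the carrier.\<close>

locale onsager_module = vector_space scale
  for scale :: "'f::field \<Rightarrow> 'v::ab_group_add \<Rightarrow> 'v" (infixr \<open>*s\<close> 75) +
  fixes q :: 'f and act :: "'f free_alg set \<Rightarrow> 'v \<Rightarrow> 'v"
  assumes act_add_right:
      "x \<in> carrier (onsager_algebra q) \<Longrightarrow> act x (v + w) = act x v + act x w"
    and act_add_left:
      "\<lbrakk>x \<in> carrier (onsager_algebra q); y \<in> carrier (onsager_algebra q)\<rbrakk>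
        \<Longrightarrow> act (x \<oplus>\<^bsub>onsager_algebra q\<^esub> y) v = act x v + act y v"
    and act_mult:
      "\<lbrakk>x \<in> carrier (onsager_algebra q); y \<in> carrier (onsager_algebra q)\<rbrakk>
        \<Longrightarrow> act (x \<otimes>\<^bsub>onsager_algebra q\<^esub> y) v = act x (act y v)"
    and act_one: "act \<one>\<^bsub>onsager_algebra q\<^esub> v = v"
    and act_scalar: "act (onsager_scalar q c) v = c *s v"
begin

definition submodule :: "'v set \<Rightarrow> bool" where
  "submodule W \<longleftrightarrow> subspace W \<and> (\<forall>x \<in> carrier (onsager_algebra q). \<forall>w \<in> W. act x w \<in> W)"

definition irreducible_module :: bool where
  "irreducible_module \<longleftrightarrow>
     (UNIV :: 'v set) \<noteq> {0} \<and> (\<forall>W. submodule W \<longrightarrow> W = {0} \<or> W = UNIV)"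

end


section \<open>Scalars\<close>

definition qpoch :: "'f::field \<Rightarrow> 'f \<Rightarrow> nat \<Rightarrow> 'f" where
  "qpoch z t n = (\<Prod>k<n. 1 - z * t ^ k)"

definition tpair :: "'f::field \<Rightarrow> (nat \<Rightarrow> 'f) \<Rightarrow> nat \<Rightarrow> nat \<Rightarrow> 'f" where
  "tpair q \<theta> i j = 1 + (\<theta> i - \<theta> j) / (q - inverse q) *
      ((q * \<theta> i - inverse q * \<theta> j) / (q^2 - inverse (q^2)))"

definition tscalar :: "'f::field \<Rightarrow> (nat \<Rightarrow> 'f) \<Rightarrow> nat \<Rightarrow> 'f" where
  "tscalar q \<theta> i = (\<Prod>k<i. tpair q \<theta> k (Suc k))"

end

theory Submission
  imports Defs
begin

text \<open>
  Both formulas are instances of one classical identity, Cauchy's expansion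
  \<open>y\<^sup>n = (\<Sum>i\<le>n. [n choose i]\<^sub>p (y - 1) (y - p) \<cdots> (y - p\<^bsup>i-1\<^esup>))\<close>
  (\<open>cauchy_q_expansion\<close>).

  Put \<open>p = q\<^sup>2\<close>, \<open>n = s - r\<close> and \<open>b = a q\<^bsup>d-2r\<^esup>\<close>, so that
  \<open>\<theta>\<^bsub>r+k\<^esub> = b p\<^bsup>-k\<^esup> + b\<^bsup>-1\<^esup> p\<^sup>k\<close> (\<open>eigenvalue_shift\<close>). The factor
  \<open>q \<theta>\<^sub>i - q\<^bsup>-1\<^esup> \<theta>\<^bsub>i+1\<^esub>\<close> in \<open>t\<^bsub>i,i+1\<^esub>\<close> collapses to a monomial in \<open>a\<close> and \<open>q\<close>, and
  \<open>t\<^bsub>i,i+1\<^esub>\<close> becomes a perfect square (\<open>tpair_neighbours\<close>). Multiplying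
  these squares gives \<open>t\<^sub>r / t\<^sub>s = y\<^sup>n\<close> for \<open>y = p\<^sup>n / b\<^sup>2\<close> (\<open>tscalar_shift\<close>).
  On the other side, each \<open>\<theta>\<^sub>r - \<theta>\<^bsub>s-j\<^esub>\<close>, together with one factor
  \<open>a\<^bsup>-1\<^esup> q\<^bsup>2s-d\<^esup> = p\<^sup>n / b\<close>, splits as \<open>(1 - p\<^bsup>n-j\<^esup>) (y - p\<^sup>j)\<close>, and so the sum
  is exactly the right side of Cauchy's identity (\<open>eigenvalue_sum\<close>).

  The second formula needs no further computation: replacing \<open>p\<close> and \<open>b\<close> by their inverses leaves
  the eigenvalues unchanged and replaces \<open>y\<close> by its inverse.
\<close>

section \<open>Cauchy's q-binomial expansion\<close>

text \<open>The Gaussian binomial coefficient. It vanishes for \<open>i > n\<close> because the factor with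
  \<open>j = n\<close> does; truncated subtraction in the later factors is therefore harmless.\<close>

definition qbinom :: "'f::field \<Rightarrow> nat \<Rightarrow> nat \<Rightarrow> 'f" where
  "qbinom p n i = (\<Prod>j<i. 1 - p ^ (n - j)) / qpoch p p i"

lemma qpoch_Suc: "qpoch z t (Suc i) = qpoch z t i * (1 - z * t ^ i)"
  by (simp add: qpoch_def)

lemma qbinom_0 [simp]: "qbinom p n 0 = 1"
  by (simp add: qbinom_def qpoch_def)

lemma qbinom_beyond: "qbinom p n (Suc n) = 0"
  by (simp add: qbinom_def)

lemma qbinom_Suc_right:
  "qbinom p n (Suc i) = qbinom p n i * (1 - p ^ (n - i)) / (1 - p ^ Suc i)"
  by (simp add: qbinom_def qpoch_Suc)

lemma qbinom_Suc_Suc: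
  "qbinom p (Suc n) (Suc i) = qbinom p n i * (1 - p ^ Suc n) / (1 - p ^ Suc i)"
  by (simp add: qbinom_def qpoch_Suc prod.lessThan_Suc_shift mult.commute del: prod.lessThan_Suc)

lemma qbinom_pascal:
  fixes p :: "'f::field"
  assumes "p ^ Suc i \<noteq> 1" and "i \<le> n"
  shows "qbinom p (Suc n) (Suc i) = p ^ Suc i * qbinom p n (Suc i) + qbinom p n i"
proof -
  have "p ^ Suc n = p ^ Suc i * p ^ (n - i)"
    using assms(2) by (simp del: power_Suc flip: power_add)
  then have numerator: "1 - p ^ Suc n = p ^ Suc i * (1 - p ^ (n - i)) + (1 - p ^ Suc i)"
    by (simp add: right_diff_distrib del: power_Suc)
  have "1 - p ^ Suc i \<noteq> 0"
    using assms(1) by simp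
  then show ?thesis
    unfolding qbinom_Suc_Suc[of p n i] qbinom_Suc_right[of p n i] numerator
    by (simp add: add_divide_distrib distrib_left mult.left_commute del: power_Suc)
qed

text \<open>By the Pascal rule, the coefficient of \<open>[n choose i]\<^sub>p\<close> in the expansion for \<open>n + 1\<close> is
  \<open>p\<^sup>i + (y - p\<^sup>i) = y\<close> times its coefficient in the expansion for \<open>n\<close>.\<close>

lemma cauchy_q_expansion:
  fixes p y :: "'f::field"
  assumes "\<And>m. m > 0 \<Longrightarrow> p ^ m \<noteq> 1"
  shows "(\<Sum>i\<le>n. qbinom p n i * (\<Prod>j<i. y - p ^ j)) = y ^ n"
proof (induction n)
  case (Suc n)
  let ?P = "\<lambda>i. \<Prod>j<i. y - p ^ j"
  let ?S = "\<lambda>n. \<Sum>i\<le>n. qbinom p n i * ?P i"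
  have "?S (Suc n) = 1 + (\<Sum>i\<le>n. qbinom p (Suc n) (Suc i) * ?P (Suc i))"
    by (subst sum.atMost_Suc_shift) simp
  also have "\<dots> = 1 + (\<Sum>i\<le>n. p ^ Suc i * qbinom p n (Suc i) * ?P (Suc i))
                  + (\<Sum>i\<le>n. qbinom p n i * ?P (Suc i))"
  proof -
    have "qbinom p (Suc n) (Suc i) = p ^ Suc i * qbinom p n (Suc i) + qbinom p n i"
      if "i \<le> n" for i
      using assms[of "Suc i"] that by (intro qbinom_pascal) simp_all
    then have "(\<Sum>i\<le>n. qbinom p (Suc n) (Suc i) * ?P (Suc i)) =
        (\<Sum>i\<le>n. (p ^ Suc i * qbinom p n (Suc i) + qbinom p n i) * ?P (Suc i))"
      by (intro sum.cong) (simp_all only: atMost_iff)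
    then show ?thesis
      by (simp only: distrib_right sum.distrib add.assoc)
  qed
  also have "1 + (\<Sum>i\<le>n. p ^ Suc i * qbinom p n (Suc i) * ?P (Suc i)) =
      (\<Sum>i\<le>Suc n. p ^ i * qbinom p n i * ?P i)"
    by (subst sum.atMost_Suc_shift) simp
  also have "\<dots> = (\<Sum>i\<le>n. p ^ i * qbinom p n i * ?P i)"
    by (simp add: qbinom_beyond)
  also have "\<dots> + (\<Sum>i\<le>n. qbinom p n i * ?P (Suc i)) = y * ?S n"
    by (simp add: sum_distrib_left flip: sum.distrib) (simp add: algebra_simps)
  finally show ?case
    using Suc by simp
qed simp

section \<open>Sums over the eigenvalue sequence\<close>

text \<open>Here \<open>\<theta> k\<close> plays the role of \<open>\<theta>\<^bsub>r+k\<^esub>\<close>. The hypothesis and the difference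
  \<open>\<theta> 0 - \<theta> (n - j)\<close> are invariant under inverting \<open>p\<close> and \<open>b\<close>, which is why one lemma
  serves both formulas.\<close>

lemma eigenvalue_sum:
  fixes p b :: "'f::field"
  assumes p: "p \<noteq> 0" "\<And>m. m > 0 \<Longrightarrow> p ^ m \<noteq> 1" and b: "b \<noteq> 0"
    and \<theta>: "\<And>k. k \<le> n \<Longrightarrow> \<theta> k = b / p ^ k + p ^ k / b"
  shows "(\<Sum>i\<le>n. (p ^ n / b) ^ i * (\<Prod>j<i. \<theta> 0 - \<theta> (n - j)) / qpoch p p i) = (p ^ n / b\<^sup>2) ^ n"
proof -
  define y where "y = p ^ n / b\<^sup>2"
  have factor: "p ^ n / b * (\<theta> 0 - \<theta> (n - j)) = (1 - p ^ (n - j)) * (y - p ^ j)"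
    if "j \<le> n" for j
  proof -
    have "p ^ n = p ^ (n - j) * p ^ j"
      using that by (simp flip: power_add)
    then show ?thesis
      using p(1) b by (simp add: \<theta> y_def field_simps power2_eq_square)
  qed
  have "(p ^ n / b) ^ i * (\<Prod>j<i. \<theta> 0 - \<theta> (n - j)) / qpoch p p i =
      qbinom p n i * (\<Prod>j<i. y - p ^ j)" if "i \<le> n" for i
  proof -
    have "(p ^ n / b) ^ i * (\<Prod>j<i. \<theta> 0 - \<theta> (n - j)) =
        (\<Prod>j<i. p ^ n / b * (\<theta> 0 - \<theta> (n - j)))"
      by (simp only: prod.distrib prod_constant card_lessThan)
    also have "\<dots> = (\<Prod>j<i. (1 - p ^ (n - j)) * (y - p ^ j))"
      using that by (intro prod.cong factor) auto
    finally show ?thesis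
      by (simp add: qbinom_def prod.distrib)
  qed
  then show ?thesis
    using cauchy_q_expansion[of p n y] p(2) by (simp add: y_def)
qed

section \<open>The scalars t\<close>

text \<open>With \<open>\<theta>\<^sub>i = u + u\<^bsup>-1\<^esup>\<close> and \<open>\<theta>\<^sub>j = u q\<^bsup>-2\<^esup> + u\<^bsup>-1\<^esup> q\<^sup>2\<close> the terms in
  \<open>u\<^bsup>-1\<^esup>\<close> of \<open>q \<theta>\<^sub>i - q\<^bsup>-1\<^esup> \<theta>\<^sub>j\<close> cancel, leaving \<open>(q\<^sup>2 - q\<^bsup>-2\<^esup>) u / q\<close>, and
  \<open>\<theta>\<^sub>i - \<theta>\<^sub>j\<close> is \<open>q - q\<^bsup>-1\<^esup>\<close> times \<open>u / q - q / u\<close>.\<close>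

lemma tpair_neighbours:
  fixes q u :: "'f::field"
  assumes q: "q \<noteq> 0" "q ^ 2 \<noteq> 1" "q ^ 4 \<noteq> 1" and u: "u \<noteq> 0"
    and i: "\<theta> i = u + 1 / u" and j: "\<theta> j = u / q\<^sup>2 + q\<^sup>2 / u"
  shows "tpair q \<theta> i j = (u / q)\<^sup>2"
proof -
  have "\<theta> i - \<theta> j = (q - inverse q) * (u / q - q / u)"
    using q(1) u by (simp add: i j field_simps power2_eq_square)
  moreover have "q - inverse q \<noteq> 0"
    using q(1,2) by (auto simp: field_simps power2_eq_square)
  moreover have "q * \<theta> i - inverse q * \<theta> j = (q\<^sup>2 - inverse (q\<^sup>2)) * (u / q)"
    using q(1) u by (simp add: i j field_simps power2_eq_square)
  moreover have "q\<^sup>2 - inverse (q\<^sup>2) \<noteq> 0"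
    using q(1,3) by (auto simp: field_simps simp flip: power_add)
  ultimately have "tpair q \<theta> i j = 1 + (u / q - q / u) * (u / q)"
    by (simp add: tpair_def)
  then show ?thesis
    using q(1) u by (simp add: field_simps power2_eq_square)
qed

text \<open>Writing \<open>p = q\<^sup>2\<close>: since \<open>t\<^bsub>r+k,r+k+1\<^esub> = b\<^sup>2 / p\<^bsup>2k+1\<^esup>\<close> and the first \<open>n\<close> odd numbers add up to \<open>n\<^sup>2\<close>,
  the quotient \<open>t\<^bsub>r+n\<^esub> / t\<^sub>r\<close> is an \<open>n\<close>-th power.\<close>

lemma tscalar_shift:
  fixes q b :: "'f::field"
  assumes q: "q \<noteq> 0" "q ^ 2 \<noteq> 1" "q ^ 4 \<noteq> 1" and b: "b \<noteq> 0"
    and \<theta>: "\<And>k. k \<le> n \<Longrightarrow> \<theta> (r + k) = b / (q\<^sup>2) ^ k + (q\<^sup>2) ^ k / b"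
  shows "tscalar q \<theta> (r + n) = tscalar q \<theta> r * (b\<^sup>2 / (q\<^sup>2) ^ n) ^ n"
proof -
  have "tscalar q \<theta> (r + m) = tscalar q \<theta> r * (b\<^sup>2 / (q\<^sup>2) ^ m) ^ m" if "m \<le> n" for m
    using that
  proof (induction m)
    case (Suc m)
    have "tpair q \<theta> (r + m) (Suc (r + m)) = (b / (q\<^sup>2) ^ m / q)\<^sup>2"
      using q b Suc.prems \<theta>[of m] \<theta>[of "Suc m"] by (intro tpair_neighbours) (simp_all add: mult.commute)
    then have "tscalar q \<theta> (r + Suc m) =
        tscalar q \<theta> r * ((b\<^sup>2 / (q\<^sup>2) ^ m) ^ m * (b / (q\<^sup>2) ^ m / q)\<^sup>2)"
      using Suc by (simp add: tscalar_def)
    also have "(b\<^sup>2 / (q\<^sup>2) ^ m) ^ m * (b / (q\<^sup>2) ^ m / q)\<^sup>2 = (b\<^sup>2 / (q\<^sup>2) ^ Suc m) ^ Suc m"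
      using q(1) by (simp add: power_divide power_mult_distrib field_simps flip: power_mult power_add power_Suc)
    finally show ?case .
  qed simp
  then show ?thesis
    by simp
qed

lemma eigenvalue_shift:
  fixes q a :: "'f::field"
  assumes "q \<noteq> 0" and "a \<noteq> 0"
    and "\<theta> (r + k) = a * q powi (int d - 2 * int (r + k)) + inverse a * q powi (2 * int (r + k) - int d)"
    and "b = a * q powi (int d - 2 * int r)"
  shows "\<theta> (r + k) = b / (q\<^sup>2) ^ k + (q\<^sup>2) ^ k / b"
proof -
  have "int d - 2 * int (r + k) = (int d - 2 * int r) - int (2 * k)"
    and "2 * int (r + k) - int d = int (2 * k) - (int d - 2 * int r)"
    by simp_all
  then have "q powi (int d - 2 * int (r + k)) = q powi (int d - 2 * int r) / (q\<^sup>2) ^ k"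
    and "q powi (2 * int (r + k) - int d) = (q\<^sup>2) ^ k / q powi (int d - 2 * int r)"
    using assms(1) by (simp_all only: power_int_diff power_int_of_nat power_mult simp_thms)
  then show ?thesis
    by (simp add: assms(3,4) divide_inverse)
qed

theorem lemma3p19:
  fixes q a :: "'f::field"
    and scale :: "'f \<Rightarrow> 'v::ab_group_add \<Rightarrow> 'v"
    and act :: "'f free_alg set \<Rightarrow> 'v \<Rightarrow> 'v"
    and \<theta> :: "nat \<Rightarrow> 'f"
    and d r s :: nat
  assumes q_nonzero: "q \<noteq> 0"
    and q_not_root_of_unity: "\<And>n::nat. n > 0 \<Longrightarrow> q ^ n \<noteq> 1"
    and V_module: "onsager_module scale q act"
    and V_irreducible: "onsager_module.irreducible_module scale q act"
    and V_finite_dim: "vector_space.finite_dim scale"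
    and V_dim: "vector_space.dim scale (UNIV :: 'v set) \<ge> 2"
    and A_diag: "vector_space.diagonalizable scale (act (onsager_A q))"
    and Astar_diag: "vector_space.diagonalizable scale (act (onsager_Astar q))"
    and d_pos: "d \<ge> 1"
    and theta_eigenvalues:
      "bij_betw \<theta> {0..d} (vector_space.eigenvalues scale (act (onsager_A q)))"
    and a_nonzero: "a \<noteq> 0"
    and theta_form:
      "\<And>i. i \<le> d \<Longrightarrow>
         \<theta> i = a * q powi (int d - 2 * int i) + inverse a * q powi (2 * int i - int d)"
    and r_le_s: "r \<le> s" and s_le_d: "s \<le> d"
  shows "tscalar q \<theta> r / tscalar q \<theta> s =
           (\<Sum>i=0..s - r. a powi (- int i) * q powi (int i * (2 * int s - int d)) *
              (\<Prod>j<i. \<theta> r - \<theta> (s - j)) / qpoch (q^2) (q^2) i)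
       \<and> tscalar q \<theta> s / tscalar q \<theta> r =
           (\<Sum>i=0..s - r. a powi (int i) * q powi (int i * (int d - 2 * int s)) *
              (\<Prod>j<i. \<theta> r - \<theta> (s - j)) / qpoch (inverse (q^2)) (inverse (q^2)) i)"
proof -
  define n where "n = s - r"
  define p where "p = q\<^sup>2"
  define b where "b = a * q powi (int d - 2 * int r)"
  have s: "s = r + n"
    using r_le_s by (simp add: n_def)
  have q24: "q ^ 2 \<noteq> 1" "q ^ 4 \<noteq> 1"
    using q_not_root_of_unity by simp_all
  have p: "p \<noteq> 0"
    using q_nonzero by (simp add: p_def)
  have p_not_root_of_unity: "p ^ m \<noteq> 1" if "m > 0" for m
    using q_not_root_of_unity[of "2 * m"] that by (simp add: p_def power_mult)
  have b: "b \<noteq> 0"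
    using q_nonzero a_nonzero by (simp add: b_def)
  have \<theta>: "\<theta> (r + k) = b / p ^ k + p ^ k / b" if "k \<le> n" for k
    unfolding p_def
    by (rule eigenvalue_shift[OF q_nonzero a_nonzero, where d = d])
      (use theta_form[of "r + k"] that s s_le_d in \<open>simp_all add: b_def\<close>)
  have differences: "(\<Sum>i\<le>n. f i * (\<Prod>j<i. \<theta> r - \<theta> (s - j)) / g i) =
      (\<Sum>i\<le>n. f i * (\<Prod>j<i. \<theta> (r + 0) - \<theta> (r + (n - j))) / g i)" for f g :: "nat \<Rightarrow> 'f"
    by (intro sum.cong arg_cong2[where f = "(/)"] arg_cong2[where f = "(*)"] prod.cong refl) (simp_all add: s)

  have t_s: "tscalar q \<theta> s = tscalar q \<theta> r * (b\<^sup>2 / p ^ n) ^ n"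
    unfolding s p_def using q_nonzero q24 b \<theta> by (intro tscalar_shift) (simp_all add: p_def)
  have "tscalar q \<theta> r \<noteq> 0"
  proof -
    \<comment> \<open>The same product formula, started at index \<open>0\<close>, exhibits \<open>t\<^sub>r\<close> as a power of a nonzero scalar.\<close>
    define c where "c = a * q powi int d"
    have "\<theta> (0 + k) = c / (q\<^sup>2) ^ k + (q\<^sup>2) ^ k / c" if "k \<le> r" for k
      by (rule eigenvalue_shift[OF q_nonzero a_nonzero, where d = d])
        (use theta_form[of k] that r_le_s s_le_d in \<open>simp_all add: c_def\<close>)
    then have "tscalar q \<theta> (0 + r) = tscalar q \<theta> 0 * (c\<^sup>2 / (q\<^sup>2) ^ r) ^ r"
      using q_nonzero q24 a_nonzero by (intro tscalar_shift) (simp_all add: c_def)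
    then show ?thesis
      using q_nonzero a_nonzero by (simp add: c_def tscalar_def)
  qed
  then have ratios: "tscalar q \<theta> r / tscalar q \<theta> s = (p ^ n / b\<^sup>2) ^ n"
    "tscalar q \<theta> s / tscalar q \<theta> r = (inverse p ^ n / (inverse b)\<^sup>2) ^ n"
    using p b by (simp_all add: t_s power_divide power_inverse field_simps)

  have base: "inverse a * q powi (2 * int s - int d) = p ^ n / b"
  proof -
    have "2 * int s - int d = int (2 * n) - (int d - 2 * int r)"
      by (simp add: s)
    then have "q powi (2 * int s - int d) = p ^ n / q powi (int d - 2 * int r)"
      using q_nonzero by (simp only: power_int_diff power_int_of_nat power_mult p_def simp_thms)
    then show ?thesis
      by (simp add: b_def divide_inverse)
  qed
  then have "inverse (inverse a * q powi (2 * int s - int d)) = inverse (p ^ n / b)"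
    by simp
  then have base_inv: "a * q powi (int d - 2 * int s) = inverse p ^ n / inverse b"
    by (simp add: power_inverse divide_inverse mult.commute flip: power_int_minus)
  have coeff: "a powi (- int i) * q powi (int i * (2 * int s - int d)) = (p ^ n / b) ^ i"
    "a powi (int i) * q powi (int i * (int d - 2 * int s)) = (inverse p ^ n / inverse b) ^ i" for i
    unfolding base[symmetric] base_inv[symmetric]
    by (simp_all add: power_mult_distrib power_int_minus power_inverse power_int_mult mult.commute[of "int i"])

  have "(\<Sum>i\<le>n. (p ^ n / b) ^ i * (\<Prod>j<i. \<theta> (r + 0) - \<theta> (r + (n - j))) / qpoch p p i) =
      (p ^ n / b\<^sup>2) ^ n"
    by (rule eigenvalue_sum[where \<theta> = "\<lambda>k. \<theta> (r + k)"]) (use p p_not_root_of_unity b \<theta> in auto)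
  moreover have "(\<Sum>i\<le>n. (inverse p ^ n / inverse b) ^ i * (\<Prod>j<i. \<theta> (r + 0) - \<theta> (r + (n - j)))
        / qpoch (inverse p) (inverse p) i) = (inverse p ^ n / (inverse b)\<^sup>2) ^ n"
  proof (rule eigenvalue_sum[where \<theta> = "\<lambda>k. \<theta> (r + k)"])
    show "\<theta> (r + k) = inverse b / inverse p ^ k + inverse p ^ k / inverse b" if "k \<le> n" for k
      using \<theta>[OF that] by (simp add: field_simps)
  qed (use p p_not_root_of_unity b in \<open>auto simp: power_inverse\<close>)
  ultimately show ?thesis
    unfolding ratios coeff n_def[symmetric] p_def[symmetric] atLeast0AtMost
    by (simp only: differences simp_thms)
qed

end
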